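(* An AHKT 8-manifold $(M,g,J_1,J_2,J_3)$ is HKT if and only if its three Lee forms are all equal, $\theta^1=\theta^2=\theta^3$.
   Context: An almost hyperhermitian 8-manifold is a Riemannian 8-manifold $(M,g)$ with almost complex structures satisfying $J_1J_2=-J_2J_1=J_3$, $J_a^2=-1$, $g(J_aX,J_aY)=g(X,Y)$; $F^a(X,Y)=g(X,J_aY)$ are the Kähler forms. It is AHKT if there is a linear connection $\nabla$ with $\nabla g=\nabla J_1=\nabla J_2=\nabla J_3=0$ and totally skew-symmetric torsion (as a $(0,3)$-tensor). It is HKT if, in addition, all three almost complex structures $J_a$ are integrable. The Lee forms are $\theta^a(X)=(\delta F^a)(J_aX)$, $a=1,2,3$, with $\delta$ the codifferential of $g$. *)

theory Defs
  imports "HOL-Analysis.Analysis"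
begin

section \<open>Smooth manifolds\<close>

primrec Ck_on :: "nat \<Rightarrow> 'a::real_normed_vector set \<Rightarrow> ('a \<Rightarrow> 'b::real_normed_vector) \<Rightarrow> bool" where
  "Ck_on 0 S f \<longleftrightarrow> continuous_on S f"
| "Ck_on (Suc k) S f \<longleftrightarrow>
     (\<forall>x\<in>S. f differentiable (at x)) \<and> (\<forall>v. Ck_on k S (\<lambda>x. frechet_derivative f (at x) v))"

text \<open>Only meant for open \<open>S\<close>: derivatives are taken along the full filter \<open>at x\<close>.\<close>

definition smooth_on :: "'a::real_normed_vector set \<Rightarrow> ('a \<Rightarrow> 'b::real_normed_vector) \<Rightarrow> bool" where
  "smooth_on S f \<longleftrightarrow> (\<forall>k. Ck_on k S f)"

text \<open>A chart is a pair of a domain and a coordinate map.\<close>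

type_synonym ('a, 'n) chart = "'a set \<times> ('a \<Rightarrow> real^'n)"

definition chart_image :: "('a, 'n::finite) chart \<Rightarrow> (real^'n) set" where
  "chart_image c = snd c ` fst c"

definition overlap :: "('a, 'n::finite) chart \<Rightarrow> ('a, 'n) chart \<Rightarrow> (real^'n) set" where
  "overlap c d = snd c ` (fst c \<inter> fst d)"

text \<open>The coordinate change from \<open>c\<close> to \<open>d\<close>, to be used on \<open>overlap c d\<close> only.\<close>

definition transition :: "('a, 'n::finite) chart \<Rightarrow> ('a, 'n) chart \<Rightarrow> real^'n \<Rightarrow> real^'n" where
  "transition c d x = snd d (inv_into (fst c) (snd c) x)"

definition chart_on :: "'a topology \<Rightarrow> ('a, 'n::finite) chart \<Rightarrow> bool" where
  "chart_on M c \<longleftrightarrow> openin M (fst c) \<and> open (chart_image c) \<and>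
     homeomorphic_map (subtopology M (fst c)) (top_of_set (chart_image c)) (snd c)"

definition second_countable_space :: "'a topology \<Rightarrow> bool" where
  "second_countable_space M \<longleftrightarrow>
     (\<exists>\<B>. countable \<B> \<and> (\<forall>B\<in>\<B>. openin M B) \<and>
          (\<forall>U x. openin M U \<and> x \<in> U \<longrightarrow> (\<exists>B\<in>\<B>. x \<in> B \<and> B \<subseteq> U)))"

text \<open>The smooth structure is the one generated by the atlas \<open>A\<close>, which need not be maximal.\<close>

definition smooth_manifold :: "'a topology \<Rightarrow> ('a, 'n::finite) chart set \<Rightarrow> bool" where
  "smooth_manifold M A \<longleftrightarrow>
     Hausdorff_space M \<and> second_countable_space M \<and>
     (\<forall>c\<in>A. chart_on M c) \<and> (\<Union>c\<in>A. fst c) = topspace M \<and>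
     (\<forall>c\<in>A. \<forall>d\<in>A. smooth_on (overlap c d) (transition c d))"


section \<open>Tensor fields and linear connections\<close>

text \<open>
  Tensor fields and connections are given by their coordinate representations: one for each chart
  \<open>c\<close>, as a function of the coordinate point \<open>x \<in> chart_image c\<close>, subject to the transformation law
  under change of charts. Values outside \<open>chart_image c\<close> are irrelevant.
\<close>

type_synonym ('a, 'n) form2_field = "('a, 'n) chart \<Rightarrow> real^'n \<Rightarrow> real^'n \<Rightarrow> real^'n \<Rightarrow> real"
type_synonym ('a, 'n) endo_field = "('a, 'n) chart \<Rightarrow> real^'n \<Rightarrow> real^'n \<Rightarrow> real^'n"
type_synonym ('a, 'n) christoffel_field = "('a, 'n) chart \<Rightarrow> real^'n \<Rightarrow> real^'n \<Rightarrow> real^'n \<Rightarrow> real^'n"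

definition riemannian_metric :: "('a, 'n::finite) chart set \<Rightarrow> ('a, 'n) form2_field \<Rightarrow> bool" where
  "riemannian_metric A g \<longleftrightarrow>
     (\<forall>c\<in>A. \<forall>x\<in>chart_image c. bilinear (g c x) \<and>
        (\<forall>v w. g c x v w = g c x w v) \<and> (\<forall>v. v \<noteq> 0 \<longrightarrow> 0 < g c x v v)) \<and>
     (\<forall>c\<in>A. \<forall>v w. smooth_on (chart_image c) (\<lambda>x. g c x v w)) \<and>
     (\<forall>c\<in>A. \<forall>d\<in>A. \<forall>x\<in>overlap c d. \<forall>v w.
        let D = frechet_derivative (transition c d) (at x)
        in g d (transition c d x) (D v) (D w) = g c x v w)"

definition endomorphism_field :: "('a, 'n::finite) chart set \<Rightarrow> ('a, 'n) endo_field \<Rightarrow> bool" where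
  "endomorphism_field A J \<longleftrightarrow>
     (\<forall>c\<in>A. \<forall>x\<in>chart_image c. linear (J c x)) \<and>
     (\<forall>c\<in>A. \<forall>v. smooth_on (chart_image c) (\<lambda>x. J c x v)) \<and>
     (\<forall>c\<in>A. \<forall>d\<in>A. \<forall>x\<in>overlap c d. \<forall>v.
        let D = frechet_derivative (transition c d) (at x)
        in J d (transition c d x) (D v) = D (J c x v))"

text \<open>
  \<open>\<Gamma> c x v w\<close> is the vector with components \<open>\<Gamma>\<^sup>k\<^sub>i\<^sub>j v\<^sup>i w\<^sup>j\<close>; the first argument is the direction of
  differentiation. The transformation law is the one making \<open>cov_deriv\<close> below chart-independent.
\<close>

definition linear_connection :: "('a, 'n::finite) chart set \<Rightarrow> ('a, 'n) christoffel_field \<Rightarrow> bool" where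
  "linear_connection A \<Gamma> \<longleftrightarrow>
     (\<forall>c\<in>A. \<forall>x\<in>chart_image c. bilinear (\<Gamma> c x)) \<and>
     (\<forall>c\<in>A. \<forall>v w. smooth_on (chart_image c) (\<lambda>x. \<Gamma> c x v w)) \<and>
     (\<forall>c\<in>A. \<forall>d\<in>A. \<forall>x\<in>overlap c d. \<forall>v w.
        let D = frechet_derivative (transition c d) (at x);
            D2 = frechet_derivative (\<lambda>y. frechet_derivative (transition c d) (at y) w) (at x) v
        in \<Gamma> d (transition c d x) (D v) (D w) = D (\<Gamma> c x v w) - D2)"


section \<open>Calculus in a chart\<close>

text \<open>
  The operations below act on the representations \<open>g\<close>, \<open>J\<close>, \<open>\<Gamma>\<close> in one fixed chart and on vector
  fields \<open>X\<close>, \<open>Y\<close>, \<open>Z\<close> on its image.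
\<close>

definition vector_fields :: "('a, 'n::finite) chart \<Rightarrow> (real^'n \<Rightarrow> real^'n) set" where
  "vector_fields c = {X. smooth_on (chart_image c) X}"

definition lie_bracket :: "(real^'n::finite \<Rightarrow> real^'n) \<Rightarrow> (real^'n \<Rightarrow> real^'n) \<Rightarrow> real^'n \<Rightarrow> real^'n" where
  "lie_bracket X Y x = frechet_derivative Y (at x) (X x) - frechet_derivative X (at x) (Y x)"

definition cov_deriv ::
  "(real^'n::finite \<Rightarrow> real^'n \<Rightarrow> real^'n \<Rightarrow> real^'n) \<Rightarrow>
   (real^'n \<Rightarrow> real^'n) \<Rightarrow> (real^'n \<Rightarrow> real^'n) \<Rightarrow> real^'n \<Rightarrow> real^'n" where
  "cov_deriv \<Gamma> X Y x = frechet_derivative Y (at x) (X x) + \<Gamma> x (X x) (Y x)"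

definition torsion ::
  "(real^'n::finite \<Rightarrow> real^'n \<Rightarrow> real^'n \<Rightarrow> real^'n) \<Rightarrow>
   (real^'n \<Rightarrow> real^'n) \<Rightarrow> (real^'n \<Rightarrow> real^'n) \<Rightarrow> real^'n \<Rightarrow> real^'n" where
  "torsion \<Gamma> X Y x = cov_deriv \<Gamma> X Y x - cov_deriv \<Gamma> Y X x - lie_bracket X Y x"

definition nijenhuis ::
  "(real^'n::finite \<Rightarrow> real^'n \<Rightarrow> real^'n) \<Rightarrow>
   (real^'n \<Rightarrow> real^'n) \<Rightarrow> (real^'n \<Rightarrow> real^'n) \<Rightarrow> real^'n \<Rightarrow> real^'n" where
  "nijenhuis J X Y x =
     (let JX = (\<lambda>y. J y (X y)); JY = (\<lambda>y. J y (Y y))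
      in lie_bracket JX JY x - J x (lie_bracket JX Y x) - J x (lie_bracket X JY x) - lie_bracket X Y x)"

text \<open>The components \<open>g\<^sup>i\<^sup>j\<close> of the inverse metric.\<close>

definition metric_inverse ::
  "(real^'n::finite \<Rightarrow> real^'n \<Rightarrow> real^'n \<Rightarrow> real) \<Rightarrow> real^'n \<Rightarrow> real^'n^'n" where
  "metric_inverse g x = matrix_inv (\<chi> i j. g x (axis i 1) (axis j 1))"

text \<open>
  The Christoffel symbols
  \<open>\<Gamma>\<^sup>k\<^sub>i\<^sub>j = 1/2 g\<^sup>k\<^sup>l (\<partial>\<^sub>i g\<^sub>j\<^sub>l + \<partial>\<^sub>j g\<^sub>i\<^sub>l - \<partial>\<^sub>l g\<^sub>i\<^sub>j)\<close> of the Levi-Civita connection, contracted with \<open>v\<close> and \<open>w\<close>.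
\<close>

definition levi_civita ::
  "(real^'n::finite \<Rightarrow> real^'n \<Rightarrow> real^'n \<Rightarrow> real) \<Rightarrow> real^'n \<Rightarrow> real^'n \<Rightarrow> real^'n \<Rightarrow> real^'n" where
  "levi_civita g x v w = (\<chi> k. 1 / 2 * (\<Sum>l\<in>UNIV. metric_inverse g x $ k $ l *
     (frechet_derivative (\<lambda>y. g y w (axis l 1)) (at x) v +
      frechet_derivative (\<lambda>y. g y v (axis l 1)) (at x) w -
      frechet_derivative (\<lambda>y. g y v w) (at x) (axis l 1))))"

text \<open>\<open>cov_deriv_form2 \<Gamma> F x u v w\<close> is \<open>(\<nabla>\<^sub>u F)(v, w)\<close> at \<open>x\<close>.\<close>

definition cov_deriv_form2 ::
  "(real^'n::finite \<Rightarrow> real^'n \<Rightarrow> real^'n \<Rightarrow> real^'n) \<Rightarrow> (real^'n \<Rightarrow> real^'n \<Rightarrow> real^'n \<Rightarrow> real) \<Rightarrow>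
   real^'n \<Rightarrow> real^'n \<Rightarrow> real^'n \<Rightarrow> real^'n \<Rightarrow> real" where
  "cov_deriv_form2 \<Gamma> F x u v w =
     frechet_derivative (\<lambda>y. F y v w) (at x) u - F x (\<Gamma> x u v) w - F x v (\<Gamma> x u w)"

text \<open>
  \<open>(\<delta>F)(w) = - \<Sum>\<^sub>a (\<nabla>\<^sup>g\<^bsub>e\<^sub>a\<^esub> F)(e\<^sub>a, w)\<close> for a \<open>g\<close>-orthonormal basis \<open>e\<^sub>a\<close>, the trace being written with
  the inverse metric in the coordinate basis.
\<close>

definition codifferential ::
  "(real^'n::finite \<Rightarrow> real^'n \<Rightarrow> real^'n \<Rightarrow> real) \<Rightarrow> (real^'n \<Rightarrow> real^'n \<Rightarrow> real^'n \<Rightarrow> real) \<Rightarrow>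
   real^'n \<Rightarrow> real^'n \<Rightarrow> real" where
  "codifferential g F x w = - (\<Sum>i\<in>UNIV. \<Sum>j\<in>UNIV. metric_inverse g x $ i $ j *
     cov_deriv_form2 (levi_civita g) F x (axis i 1) (axis j 1) w)"

definition kaehler_form ::
  "(real^'n::finite \<Rightarrow> real^'n \<Rightarrow> real^'n \<Rightarrow> real) \<Rightarrow> (real^'n \<Rightarrow> real^'n \<Rightarrow> real^'n) \<Rightarrow>
   real^'n \<Rightarrow> real^'n \<Rightarrow> real^'n \<Rightarrow> real" where
  "kaehler_form g J x v w = g x v (J x w)"

definition lee_form ::
  "(real^'n::finite \<Rightarrow> real^'n \<Rightarrow> real^'n \<Rightarrow> real) \<Rightarrow> (real^'n \<Rightarrow> real^'n \<Rightarrow> real^'n) \<Rightarrow>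
   real^'n \<Rightarrow> real^'n \<Rightarrow> real" where
  "lee_form g J x v = codifferential g (kaehler_form g J) x (J x v)"


section \<open>Almost hyperhermitian, AHKT and HKT manifolds\<close>

definition almost_hyperhermitian ::
  "'a topology \<Rightarrow> ('a, 'n::finite) chart set \<Rightarrow> ('a, 'n) form2_field \<Rightarrow>
   ('a, 'n) endo_field \<Rightarrow> ('a, 'n) endo_field \<Rightarrow> ('a, 'n) endo_field \<Rightarrow> bool" where
  "almost_hyperhermitian M A g J1 J2 J3 \<longleftrightarrow>
     smooth_manifold M A \<and> riemannian_metric A g \<and>
     endomorphism_field A J1 \<and> endomorphism_field A J2 \<and> endomorphism_field A J3 \<and>
     (\<forall>c\<in>A. \<forall>x\<in>chart_image c. \<forall>v.
        J1 c x (J2 c x v) = J3 c x v \<and> J2 c x (J1 c x v) = - J3 c x v) \<and>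
     (\<forall>J\<in>{J1, J2, J3}. \<forall>c\<in>A. \<forall>x\<in>chart_image c. \<forall>v w.
        J c x (J c x v) = - v \<and> g c x (J c x v) (J c x w) = g c x v w)"

definition parallel_metric ::
  "('a, 'n::finite) chart set \<Rightarrow> ('a, 'n) christoffel_field \<Rightarrow> ('a, 'n) form2_field \<Rightarrow> bool" where
  "parallel_metric A \<Gamma> g \<longleftrightarrow>
     (\<forall>c\<in>A. \<forall>X\<in>vector_fields c. \<forall>Y\<in>vector_fields c. \<forall>Z\<in>vector_fields c. \<forall>x\<in>chart_image c.
        frechet_derivative (\<lambda>y. g c y (Y y) (Z y)) (at x) (X x) =
        g c x (cov_deriv (\<Gamma> c) X Y x) (Z x) + g c x (Y x) (cov_deriv (\<Gamma> c) X Z x))"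

definition parallel_endo ::
  "('a, 'n::finite) chart set \<Rightarrow> ('a, 'n) christoffel_field \<Rightarrow> ('a, 'n) endo_field \<Rightarrow> bool" where
  "parallel_endo A \<Gamma> J \<longleftrightarrow>
     (\<forall>c\<in>A. \<forall>X\<in>vector_fields c. \<forall>Y\<in>vector_fields c. \<forall>x\<in>chart_image c.
        cov_deriv (\<Gamma> c) X (\<lambda>y. J c y (Y y)) x = J c x (cov_deriv (\<Gamma> c) X Y x))"

text \<open>
  Skew-symmetry of \<open>T(X, Y, Z) = g(T(X, Y), Z)\<close> in the last two arguments; in the first two it holds
  for every torsion.
\<close>

definition skew_torsion ::
  "('a, 'n::finite) chart set \<Rightarrow> ('a, 'n) christoffel_field \<Rightarrow> ('a, 'n) form2_field \<Rightarrow> bool" where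
  "skew_torsion A \<Gamma> g \<longleftrightarrow>
     (\<forall>c\<in>A. \<forall>X\<in>vector_fields c. \<forall>Y\<in>vector_fields c. \<forall>Z\<in>vector_fields c. \<forall>x\<in>chart_image c.
        g c x (torsion (\<Gamma> c) X Y x) (Z x) = - g c x (torsion (\<Gamma> c) X Z x) (Y x))"

definition AHKT ::
  "'a topology \<Rightarrow> ('a, 'n::finite) chart set \<Rightarrow> ('a, 'n) form2_field \<Rightarrow>
   ('a, 'n) endo_field \<Rightarrow> ('a, 'n) endo_field \<Rightarrow> ('a, 'n) endo_field \<Rightarrow> bool" where
  "AHKT M A g J1 J2 J3 \<longleftrightarrow>
     almost_hyperhermitian M A g J1 J2 J3 \<and>
     (\<exists>\<Gamma>. linear_connection A \<Gamma> \<and> parallel_metric A \<Gamma> g \<and>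
          parallel_endo A \<Gamma> J1 \<and> parallel_endo A \<Gamma> J2 \<and> parallel_endo A \<Gamma> J3 \<and>
          skew_torsion A \<Gamma> g)"

text \<open>Integrability of an almost complex structure is understood as vanishing of its Nijenhuis tensor.\<close>

definition integrable_acs :: "('a, 'n::finite) chart set \<Rightarrow> ('a, 'n) endo_field \<Rightarrow> bool" where
  "integrable_acs A J \<longleftrightarrow>
     (\<forall>c\<in>A. \<forall>X\<in>vector_fields c. \<forall>Y\<in>vector_fields c. \<forall>x\<in>chart_image c. nijenhuis (J c) X Y x = 0)"

definition HKT ::
  "'a topology \<Rightarrow> ('a, 'n::finite) chart set \<Rightarrow> ('a, 'n) form2_field \<Rightarrow>
   ('a, 'n) endo_field \<Rightarrow> ('a, 'n) endo_field \<Rightarrow> ('a, 'n) endo_field \<Rightarrow> bool" where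
  "HKT M A g J1 J2 J3 \<longleftrightarrow>
     AHKT M A g J1 J2 J3 \<and> integrable_acs A J1 \<and> integrable_acs A J2 \<and> integrable_acs A J3"

end

(*
  Everything happens at a point. The given connection has the torsion three-form T, the Levi-Civita
  connection is its symmetric part, and parallelism of the structures gives
    g(N_a(X,Y),Z) = T(X,Y,Z) - T(J_a X,J_a Y,Z) - T(J_a X,Y,J_a Z) - T(X,J_a Y,J_a Z),
    theta^a(X) = -1/2 sum_i T(J_a X, e_i, J_a e_i).
  Contracting N_1 with F^2 gives a multiple of theta^2 - theta^3, up to composition with J_2. In
  dimension 8, N_1 is a (3,0)+(0,3) form for J_1 on C^4, and wedging with the symplectic (2,0)-form
  identifies these with vectors; so N_1 is determined by this contraction, and N_1 = 0 if and only
  if theta^2 = theta^3. The theorem follows by cyclic permutation of the J_a.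
*)

theory Submission
  imports Defs
begin

section \<open>Inner products and traces\<close>

locale inner_form =
  fixes h :: "'v::euclidean_space \<Rightarrow> 'v \<Rightarrow> real"
  assumes bilin: "bilinear h"
    and sym: "h u v = h v u"
    and pos: "v \<noteq> 0 \<Longrightarrow> 0 < h v v"
begin

lemmas h_simps [simp] =
  bilinear_ladd [OF bilin] bilinear_radd [OF bilin] bilinear_lsub [OF bilin] bilinear_rsub [OF bilin]
  bilinear_lmul [OF bilin] bilinear_rmul [OF bilin] bilinear_lneg [OF bilin] bilinear_rneg [OF bilin]
  bilinear_lzero [OF bilin] bilinear_rzero [OF bilin]

lemma linear_left: "linear (\<lambda>u. h u v)" and linear_right: "linear (h v)"
  using bilin by (auto simp: bilinear_def)

lemma h_sum_left: "h (\<Sum>i\<in>I. f i) v = (\<Sum>i\<in>I. h (f i) v)"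
  using linear_sum [OF linear_left] by blast

lemma nondegenerate: "(\<And>w. h v w = 0) \<Longrightarrow> v = 0"
  using pos [of v] by force

definition orthonormal :: "'v set \<Rightarrow> bool" where
  "orthonormal U \<longleftrightarrow> (\<forall>u\<in>U. \<forall>v\<in>U. h u v = (if u = v then 1 else 0))"

lemma orthogonal_span:
  assumes "\<And>u. u \<in> U \<Longrightarrow> h a u = 0" and "v \<in> span U"
  shows "h a v = 0"
  using linear_eq_0_on_span [OF linear_right assms] by blast

lemma orthonormal_independent:
  assumes "orthonormal U"
  shows "independent U"
proof
  assume "dependent U"
  then obtain a where a: "a \<in> U" "a \<in> span (U - {a})"
    by (auto simp: dependent_def)
  have "h a a = 0"
    by (rule orthogonal_span [OF _ a(2)]) (use assms a in \<open>auto simp: orthonormal_def\<close>)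
  then show False
    using assms a by (auto simp: orthonormal_def)
qed

lemma orthonormal_residual:
  assumes "orthonormal U" "finite U" "v \<in> U"
  shows "h (z - (\<Sum>u\<in>U. h z u *\<^sub>R u)) v = 0"
proof -
  have "(\<Sum>u\<in>U. h z u * h u v) = (\<Sum>u\<in>U. if u = v then h z u else 0)"
    using assms by (intro sum.cong) (auto simp: orthonormal_def)
  then show ?thesis
    using assms by (simp add: h_sum_left)
qed

lemma orthonormal_expansion:
  assumes "orthonormal U" "finite U" "span U = UNIV"
  shows "z = (\<Sum>u\<in>U. h z u *\<^sub>R u)"
proof -
  have "h (z - (\<Sum>u\<in>U. h z u *\<^sub>R u)) w = 0" for w
  proof (rule orthogonal_span)
    show "w \<in> span U"
      unfolding assms(3) by (rule UNIV_I)
  qed (rule orthonormal_residual [OF assms(1,2)])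
  then have "z - (\<Sum>u\<in>U. h z u *\<^sub>R u) = 0"
    by (rule nondegenerate)
  then show ?thesis
    by simp
qed

text \<open>One Gram-Schmidt step: a vector outside \<open>span U\<close> has a nonzero residual,
  which is then normalised.\<close>

lemma unit_vector_orthogonal:
  assumes "orthonormal U" "finite U" "span U \<noteq> UNIV"
  obtains w where "h w w = 1" "\<And>u. u \<in> U \<Longrightarrow> h w u = 0"
proof -
  obtain z where z: "z \<notin> span U"
    using assms by blast
  define y where "y = z - (\<Sum>u\<in>U. h z u *\<^sub>R u)"
  have "y \<noteq> 0"
    using z span_sum [OF span_scale [OF span_base], of U "\<lambda>u. u" U "h z"] by (auto simp: y_def)
  then have p: "0 < h y y"
    by (rule pos)
  show ?thesis
  proof
    show "h ((1 / sqrt (h y y)) *\<^sub>R y) ((1 / sqrt (h y y)) *\<^sub>R y) = 1"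
      using p by (simp add: divide_simps)
    show "h ((1 / sqrt (h y y)) *\<^sub>R y) u = 0" if "u \<in> U" for u
      using orthonormal_residual [OF assms(1,2) that] by (simp add: y_def)
  qed
qed

end

section \<open>The trace taken with the inverse metric\<close>

lemma linear_axis_expansion:
  assumes "linear f"
  shows "f z = (\<Sum>i\<in>UNIV. z $ i *\<^sub>R f (axis i 1))"
proof -
  have "f z = f (\<Sum>i\<in>UNIV. (z $ i) *\<^sub>R axis i 1)"
    by (metis basis_expansion scalar_mult_eq_scaleR)
  then show ?thesis
    using assms by (simp add: linear_sum linear_scale)
qed

text \<open>\<open>h\<close> is a form on a single tangent space, extended to a constant field for \<open>metric_inverse\<close>.\<close>

definition metric_trace ::
  "(real^'n::finite \<Rightarrow> real^'n \<Rightarrow> real) \<Rightarrow> (real^'n \<Rightarrow> real^'n \<Rightarrow> real) \<Rightarrow> real" where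
  "metric_trace h B =
     (\<Sum>i\<in>UNIV. \<Sum>j\<in>UNIV. metric_inverse (\<lambda>_. h) 0 $ i $ j * B (axis i 1) (axis j 1))"

context
  fixes h :: "real^'n::finite \<Rightarrow> real^'n \<Rightarrow> real"
  assumes h: "inner_form h"
begin

interpretation inner_form h
  by (rule h)

text \<open>Raising a lowered index gives the vector back. The Gram matrix \<open>G\<close> sends
  \<open>z\<close> to the components of the covector \<open>h z\<close>; nondegeneracy makes it
  injective, hence invertible.\<close>

lemma metric_inverse_component:
  "(\<Sum>l\<in>UNIV. metric_inverse (\<lambda>_. h) 0 $ k $ l * h z (axis l 1)) = z $ k"
proof -
  define G :: "real^'n^'n" where "G = (\<chi> i j. h (axis i 1) (axis j 1))"
  have G: "G *v y = (\<chi> l. h y (axis l 1))" for y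
    unfolding G_def matrix_vector_mult_def vec_eq_iff
    by (subst linear_axis_expansion [OF linear_left]) (simp add: sym mult.commute)
  have "inj ((*v) G)"
  proof (rule injI)
    fix y y' assume "G *v y = G *v y'"
    then have "h (y - y') (axis l 1) = 0" for l
      by (simp add: G vec_eq_iff)
    then have "h (y - y') w = 0" for w
      by (subst linear_axis_expansion [OF linear_right]) simp
    then have "y - y' = 0"
      by (rule nondegenerate)
    then show "y = y'"
      by simp
  qed
  then have "invertible G"
    using invertible_left_inverse matrix_left_invertible_injective by blast
  then have "matrix_inv G ** G = mat 1"
    unfolding invertible_def matrix_inv_def by (rule someI2_ex) simp
  then have "matrix_inv G *v (G *v z) = z"
    by (simp add: matrix_vector_mul_assoc)
  then show ?thesis
    by (simp add: G metric_inverse_def flip: G_def)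
      (simp add: matrix_vector_mult_def vec_eq_iff)
qed

text \<open>Expand the second axis vector in \<open>U\<close>. Contracting the inverse metric with
  \<open>h u\<close> then yields the coordinates of \<open>u\<close>, and linearity in the first
  slot reassembles \<open>B u u\<close>.\<close>

lemma metric_trace_orthonormal:
  assumes "orthonormal U" "finite U" "span U = UNIV" and B: "bilinear B"
  shows "metric_trace h B = (\<Sum>u\<in>U. B u u)"
proof -
  let ?m = "metric_inverse (\<lambda>_. h) 0"
  have lin: "linear (B v)" "linear (\<lambda>w. B w v)" for v
    using B by (auto simp: bilinear_def)
  have *: "B (axis i 1) (axis j 1) = (\<Sum>u\<in>U. h u (axis j 1) * B (axis i 1) u)" for i j
    by (subst orthonormal_expansion [OF assms(1-3), of "axis j 1"])
      (simp add: linear_sum [OF lin(1)] linear_scale [OF lin(1)] sym)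
  have "metric_trace h B =
      (\<Sum>i\<in>UNIV. \<Sum>j\<in>UNIV. \<Sum>u\<in>U. ?m $ i $ j * h u (axis j 1) * B (axis i 1) u)"
    by (simp add: metric_trace_def * sum_distrib_left mult.assoc)
  also have "\<dots> = (\<Sum>i\<in>UNIV. \<Sum>u\<in>U. \<Sum>j\<in>UNIV. ?m $ i $ j * h u (axis j 1) * B (axis i 1) u)"
    by (subst (2) sum.swap) simp
  also have "\<dots> = (\<Sum>i\<in>UNIV. \<Sum>u\<in>U. u $ i * B (axis i 1) u)"
    by (simp add: metric_inverse_component flip: sum_distrib_right)
  also have "\<dots> = (\<Sum>u\<in>U. \<Sum>i\<in>UNIV. u $ i * B (axis i 1) u)"
    by (rule sum.swap)
  also have "\<dots> = (\<Sum>u\<in>U. B u u)"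
    by (intro sum.cong refl linear_axis_expansion [OF lin(2), symmetric, unfolded real_scaleR_def])
  finally show ?thesis .
qed

end

section \<open>Three-forms on a quaternionic plane\<close>

locale hyperhermitian_space = inner_form h
  for h :: "'v::euclidean_space \<Rightarrow> 'v \<Rightarrow> real" +
  fixes I J K :: "'v \<Rightarrow> 'v"
  assumes lin: "linear I" "linear J" "linear K"
    and IJ: "I (J v) = K v" and JI: "J (I v) = - K v"
    and square: "I (I v) = - v" "J (J v) = - v" "K (K v) = - v"
    and isometry: "h (I v) (I w) = h v w" "h (J v) (J w) = h v w" "h (K v) (K w) = h v w"
begin

lemmas lin_simps [simp] = lin [THEN linear_neg] lin [THEN linear_add] lin [THEN linear_scale]

lemma quaternion [simp]:
  "I (I v) = - v" "J (J v) = - v" "K (K v) = - v"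
  "I (J v) = K v" "J (I v) = - K v" "J (K v) = I v" "K (J v) = - I v" "K (I v) = J v" "I (K v) = - J v"
proof -
  show K: "I (K v) = - J v" for v
    using square(1) [of "J v"] by (simp add: IJ)
  have "J (K v) = J (- J (I v))"
    by (simp only: JI minus_minus)
  then show "J (K v) = I v"
    by (simp add: square)
  have "K (J v) = I (J (J v))" "K (I v) = I (J (I v))"
    by (simp_all only: IJ)
  then show "K (J v) = - I v" "K (I v) = J v"
    by (simp_all add: square JI K)
qed (simp_all add: IJ JI square)

lemma skew [simp]: "h u (I v) = - h (I u) v" "h u (J v) = - h (J u) v" "h u (K v) = - h (K u) v"
  using isometry(1) [of "I u" v] isometry(2) [of "J u" v] isometry(3) [of "K u" v]
  by simp_all

lemma skew_self [simp]: "h (I v) v = 0" "h (J v) v = 0" "h (K v) v = 0"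
proof -
  show "h (I v) v = 0"
    using skew(1) [of v v] sym [of v "I v"] by linarith
  show "h (J v) v = 0"
    using skew(2) [of v v] sym [of v "J v"] by linarith
  show "h (K v) v = 0"
    using skew(3) [of v v] sym [of v "K v"] by linarith
qed

text \<open>The quaternion relations are invariant under cyclic permutation, so whatever is proved
  for \<open>I\<close> carries over to \<open>J\<close> and \<open>K\<close>.\<close>

lemma rotate: "hyperhermitian_space h J K I"
  by unfold_locales (simp_all add: lin isometry del: skew)

text \<open>A real spanning set of the quaternionic line through \<open>e\<close>.\<close>

definition line :: "'v \<Rightarrow> 'v set" where
  "line e = {e, I e, J e, K e}"

lemma line_orthonormal:
  assumes "h e e = 1"
  shows "orthonormal (line e)" "card (line e) = 4"
    and "\<And>p. (\<Sum>u\<in>line e. p u :: real) = p e + p (I e) + p (J e) + p (K e)"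
proof -
  have ne: "x \<noteq> y" if "h x x = 1" "h x y = 0" for x y
    using that by auto
  have *: "e \<noteq> I e" "e \<noteq> J e" "e \<noteq> K e" "I e \<noteq> J e" "I e \<noteq> K e" "J e \<noteq> K e"
    by (rule ne; simp add: assms)+
  show "orthonormal (line e)"
    using assms * *[symmetric] by (auto simp: orthonormal_def line_def)
  show "card (line e) = 4"
    using * by (simp add: line_def)
  show "(\<Sum>u\<in>line e. p u) = p e + p (I e) + p (J e) + p (K e)" for p :: "'v \<Rightarrow> real"
    using * by (simp add: line_def)
qed

text \<open>The orthogonal complement of a quaternionic line is stable under \<open>I\<close>,
  \<open>J\<close>, \<open>K\<close>. In dimension 8 = 4 + 4 any unit vector \<open>f\<close> of it
  therefore completes \<open>line e\<close> to an orthonormal basis.\<close>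

lemma adapted_basis:
  assumes dim: "DIM('v) = 8"
  obtains e f where "orthonormal (line e \<union> line f)" "span (line e \<union> line f) = UNIV"
    "line e \<inter> line f = {}" "h e e = 1" "h f f = 1"
proof -
  \<comment> \<open>The first unit vector is obtained as one orthogonal to the empty system.\<close>
  have "orthonormal {}" "span {} \<noteq> (UNIV :: 'v set)"
    using dim dim_UNIV [where 'a='v] by (auto simp: orthonormal_def)
  then obtain e where e: "h e e = 1"
    by (metis finite.emptyI unit_vector_orthogonal)
  have fin: "finite (line v)" for v
    by (simp add: line_def)
  have "dim (line e) < 8"
    using dim_le_card' [OF fin, of e] line_orthonormal [OF e] by simp
  then have "span (line e) \<noteq> UNIV"
    using dim by (metis dim_UNIV dim_span less_irrefl)
  then obtain f where f: "h f f = 1" and ef: "\<And>u. u \<in> line e \<Longrightarrow> h f u = 0"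
    using unit_vector_orthogonal [OF line_orthonormal(1) [OF e] fin] by blast
  have 1: "h f e = 0" "h (I f) e = 0" "h (J f) e = 0" "h (K f) e = 0"
    using ef [of e] ef [of "I e"] ef [of "J e"] ef [of "K e"] by (auto simp: line_def)
  then have 2: "h e f = 0" "h (I e) f = 0" "h (J e) f = 0" "h (K e) f = 0"
    using ef by (simp_all add: sym [of _ f] line_def del: skew)
  have orth: "h u v = 0" "h v u = 0" if "u \<in> line e" "v \<in> line f" for u v
    using that 1 2 by (auto simp: line_def)
  have disj: "line e \<inter> line f = {}"
    using orth line_orthonormal(1) [OF e] by (force simp: orthonormal_def)
  have on: "orthonormal (line e \<union> line f)"
    using orth disj line_orthonormal(1) [OF e] line_orthonormal(1) [OF f]
    unfolding orthonormal_def by (metis IntI UnE empty_iff)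
  have "card (line e \<union> line f) = 8"
    using card_Un_disjoint [OF fin fin disj] line_orthonormal(2) e f by simp
  then have "UNIV \<subseteq> span (line e \<union> line f)"
    using dim by (intro card_ge_dim_independent orthonormal_independent on) auto
  then show ?thesis
    using that on disj e f by blast
qed

end

text \<open>
  Four times the (3,0)+(0,3) part of \<open>T\<close> with respect to \<open>A\<close>. For the torsion \<open>T\<close> of a connection
  preserving \<open>A\<close> it is the Nijenhuis tensor with lowered index.
\<close>

definition nij3 :: "('a::real_vector \<Rightarrow> 'a) \<Rightarrow> ('a \<Rightarrow> 'a \<Rightarrow> 'a \<Rightarrow> real) \<Rightarrow> 'a \<Rightarrow> 'a \<Rightarrow> 'a \<Rightarrow> real" where
  "nij3 A T x y z = T x y z - T (A x) (A y) z - T (A x) y (A z) - T x (A y) (A z)"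

section \<open>Three-forms and their (3,0)+(0,3) part\<close>

locale three_form =
  fixes T :: "'v::real_vector \<Rightarrow> 'v \<Rightarrow> 'v \<Rightarrow> real"
  assumes linear1: "linear (\<lambda>x. T x y z)"
    and swap12: "T y x z = - T x y z"
    and swap23: "T x z y = - T x y z"
begin

lemma linear2: "linear (\<lambda>y. T x y z)"
  using linear_compose_neg [OF linear1 [of x z]] by (simp flip: swap12)

lemma linear3: "linear (\<lambda>z. T x y z)"
  using linear_compose_neg [OF linear2 [of x y]] by (simp flip: swap23)

lemmas T_simps [simp] =
  linear1 [THEN linear_add] linear1 [THEN linear_neg] linear1 [THEN linear_0]
  linear2 [THEN linear_add] linear2 [THEN linear_neg] linear2 [THEN linear_0]
  linear3 [THEN linear_add] linear3 [THEN linear_neg] linear3 [THEN linear_0]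

lemma T_scale [simp]:
  "T (c *\<^sub>R x) y z = c * T x y z" "T x (c *\<^sub>R y) z = c * T x y z" "T x y (c *\<^sub>R z) = c * T x y z"
  using linear1 [THEN linear_scale] linear2 [THEN linear_scale] linear3 [THEN linear_scale] by auto

lemma alternating [simp]: "T x x z = 0" "T x y y = 0"
  using swap12 [of x x z] swap23 [of x y y] by auto

end

locale hyperhermitian_three_form = hyperhermitian_space h I J K + three_form T
  for h :: "'v::euclidean_space \<Rightarrow> 'v \<Rightarrow> real" and I J K and T :: "'v \<Rightarrow> 'v \<Rightarrow> 'v \<Rightarrow> real"
begin

lemma nij3_three_form: "three_form (nij3 I T)"
proof (rule three_form.intro)
  show "linear (\<lambda>x. nij3 I T x y z)" for y z
    by (rule linearI) (simp_all add: nij3_def algebra_simps)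
  show "nij3 I T y x z = - nij3 I T x y z" for x y z
    unfolding nij3_def
    using swap12 [of y x z] swap12 [of "I y" "I x" z] swap12 [of "I y" x "I z"] swap12 [of y "I x" "I z"]
    by linarith
  show "nij3 I T x z y = - nij3 I T x y z" for x y z
    unfolding nij3_def
    using swap23 [of x z y] swap23 [of "I x" "I z" y] swap23 [of "I x" z "I y"] swap23 [of x "I z" "I y"]
    by linarith
qed

text \<open>All these values equal T(Ix,y,z) + T(x,Iy,z) + T(x,y,Iz) - T(Ix,Iy,Iz), which treats the
  three slots alike. That \<open>I\<close> moves freely between slots expresses the type
  (3,0)+(0,3).\<close>

lemma nij3_shift: "nij3 I T (I x) y z = nij3 I T x (I y) z" "nij3 I T x (I y) z = nij3 I T x y (I z)"
  by (simp_all add: nij3_def)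

text \<open>The contribution of one quaternionic line to the trace; an adapted basis in dimension 8
  consists of two such lines.\<close>

definition half_trace :: "('v \<Rightarrow> 'v \<Rightarrow> real) \<Rightarrow> 'v \<Rightarrow> real" where
  "half_trace B e = B e e + B (I e) (I e) + B (J e) (J e) + B (K e) (K e)"

text \<open>By skew-symmetry the four summands of each half trace agree in pairs, for instance those
  at \<open>e\<close> and \<open>J e\<close>. What remains is twice the four terms of
  \<open>nij3\<close>.\<close>

lemma nij3_contraction:
  "2 * nij3 I T x e (J e) =
     half_trace (\<lambda>u v. T x u (J v)) e - half_trace (\<lambda>u v. T (I x) u (K v)) e"
  using swap23 [of x "J e" e] swap23 [of x "K e" "I e"]
    swap23 [of "I x" "J e" "I e"] swap23 [of "I x" "K e" e]
  by (simp add: nij3_def half_trace_def)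

text \<open>Over the complex numbers acting through \<open>I\<close>, the vectors \<open>e\<close>,
  \<open>J e\<close>, \<open>f\<close>, \<open>J f\<close> span. Any three of them include a pair
  from one line, so the form is determined by its contractions with (\<open>e\<close>,
  \<open>J e\<close>) and (\<open>f\<close>, \<open>J f\<close>). These are opposite by
  \<open>contr\<close>, and each vanishes on its own line, hence both vanish.\<close>

lemma nij3_eq_0:
  assumes span: "span (line e \<union> line f) = UNIV"
    and contr: "\<And>x. nij3 I T x e (J e) + nij3 I T x f (J f) = 0"
  shows "nij3 I T x y z = 0"
proof -
  interpret N: three_form "nij3 I T"
    by (rule nij3_three_form)
  \<comment> \<open>Since K = IJ, the factor \<open>I\<close> can be pushed into the last slot,
    leaving only \<open>J\<close> behind.\<close>
  have K_shift: "nij3 I T (K x) y z = nij3 I T (J x) y (I z)" "nij3 I T x (K y) z = nij3 I T x (J y) (I z)"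
    for x y z
    using nij3_shift [of "J x" y z] nij3_shift [of x "J y" z] by simp_all
  have cyclic: "nij3 I T v w u = nij3 I T u v w" for u v w
    using N.swap12 N.swap23 by metis
  have basis: "p w = 0" if "linear p" "\<And>u. u \<in> line e \<union> line f \<Longrightarrow> p u = 0" for p :: "'v \<Rightarrow> real" and w
  proof -
    have w: "w \<in> span (line e \<union> line f)"
      unfolding span by (rule UNIV_I)
    show ?thesis
      using linear_eq_0_on_span [OF that w] by blast
  qed
  have contr': "nij3 I T e (J e) x = - nij3 I T f (J f) x" for x
    using contr [of x] cyclic [of e "J e" x] cyclic [of f "J f" x] by linarith
  \<comment> \<open>Moving \<open>I\<close> between two slots that hold the same vector preserves
    the value, while exchanging the slots reverses its sign.\<close>
  have N0: "nij3 I T x y x = 0" "nij3 I T x y (I x) = 0" "nij3 I T x y (I y) = 0" for x y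
  proof -
    show "nij3 I T x y x = 0"
      using cyclic [of x y x] by simp
    show "nij3 I T x y (I x) = 0"
      using nij3_shift(1) [of x x y] cyclic [of x y "I x"] N.swap12 [of x "I x" y] by linarith
    show "nij3 I T x y (I y) = 0"
      using N.swap23 [of x y "I y"] nij3_shift(2) [of x y y] by linarith
  qed
  have vanish: "nij3 I T c (J c) u = 0" if "u \<in> line c" for c u
    using that N0(1) [of c "J c"] N0(2) [of c "J c"] N0(3) [of c "J c"] by (auto simp: line_def)
  \<comment> \<open>On \<open>line f\<close> this is \<open>vanish\<close>; on \<open>line e\<close>
    it is minus the contraction with (\<open>e\<close>, \<open>J e\<close>), to which
    \<open>vanish\<close> applies.\<close>
  have f0: "nij3 I T f (J f) w = 0" for w
  proof (rule basis [OF N.linear3])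
    fix u assume "u \<in> line e \<union> line f"
    then have "nij3 I T e (J e) u = 0 \<or> nij3 I T f (J f) u = 0"
      using vanish by blast
    then show "nij3 I T f (J f) u = 0"
      using contr' [of u] by auto
  qed
  then have e0: "nij3 I T e (J e) w = 0" for w
    by (simp add: contr')
  \<comment> \<open>Once every \<open>I\<close> sits in the last slot, the first two slots hold only
    \<open>c\<close> or \<open>J c\<close>.\<close>
  have same_line: "nij3 I T u v w = 0" if "u \<in> line c \<and> v \<in> line c" "c = e \<or> c = f" for u v w c
  proof -
    have c0: "nij3 I T c (J c) w = 0" "nij3 I T (J c) c w = 0" for w
      using that e0 f0 N.swap12 [of c "J c" w] by auto
    show ?thesis
      using that(1) by (auto simp: line_def nij3_shift K_shift c0)
  qed
  \<comment> \<open>Pigeonhole: two of the three vectors share a line, and a cyclic rotation brings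
    them to the front.\<close>
  have zero3: "nij3 I T u v w = 0"
    if "u \<in> line e \<union> line f" "v \<in> line e \<union> line f" "w \<in> line e \<union> line f" for u v w
    using that same_line cyclic by (metis Un_iff)
  have zero2: "nij3 I T u v z = 0" if "u \<in> line e \<union> line f" "v \<in> line e \<union> line f" for u v
    by (rule basis [OF N.linear3]) (rule zero3 [OF that])
  have zero1: "nij3 I T u y z = 0" if "u \<in> line e \<union> line f" for u
    by (rule basis [OF N.linear2]) (rule zero2 [OF that])
  show ?thesis
    by (rule basis [OF N.linear1]) (rule zero1)
qed

end

text \<open>For a torsion form the two traces are, up to the factor -1/2, the Lee forms of
  \<open>J\<close> and \<open>K\<close> (see \<open>lee_form_eq\<close>). Adding
  \<open>nij3_contraction\<close> over both lines of an adapted basis turns their difference into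
  the contraction that determines \<open>nij3 I T\<close>.\<close>

lemma nij3_eq_0_iff_traces:
  fixes h :: "real^8 \<Rightarrow> real^8 \<Rightarrow> real"
  assumes "hyperhermitian_three_form h I J K T"
  shows "(\<forall>x y z. nij3 I T x y z = 0) \<longleftrightarrow>
    (\<forall>x. metric_trace h (\<lambda>u v. T (J x) u (J v)) = metric_trace h (\<lambda>u v. T (K x) u (K v)))"
proof -
  interpret hyperhermitian_three_form h I J K T
    by (rule assms)
  obtain e f where on: "orthonormal (line e \<union> line f)" and span: "span (line e \<union> line f) = UNIV"
    and disj: "line e \<inter> line f = {}" and unit: "h e e = 1" "h f f = 1"
    by (rule adapted_basis) auto
  have fin: "finite (line v)" for v
    by (simp add: line_def)
  have trace: "metric_trace h B = half_trace B e + half_trace B f" if "bilinear B" for B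
    using metric_trace_orthonormal [OF inner_form_axioms on _ span that] fin disj
    by (simp add: sum.union_disjoint line_orthonormal(3) unit half_trace_def)
  have bil: "bilinear (\<lambda>u v. T x u (J v))" "bilinear (\<lambda>u v. T x u (K v))" for x
    by (auto simp: bilinear_def linear2 intro!: linearI)
  have contr: "2 * (nij3 I T x e (J e) + nij3 I T x f (J f)) =
      metric_trace h (\<lambda>u v. T x u (J v)) - metric_trace h (\<lambda>u v. T (I x) u (K v))" for x
    using nij3_contraction [of x e] nij3_contraction [of x f] by (simp add: trace bil)
  show ?thesis
  proof (intro iffI allI)
    fix x
    assume "\<forall>x y z. nij3 I T x y z = 0"
    then show "metric_trace h (\<lambda>u v. T (J x) u (J v)) = metric_trace h (\<lambda>u v. T (K x) u (K v))"
      using contr [of "J x"] by simp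
  next
    fix x y z
    assume *: "\<forall>x. metric_trace h (\<lambda>u v. T (J x) u (J v)) = metric_trace h (\<lambda>u v. T (K x) u (K v))"
    have "nij3 I T x e (J e) + nij3 I T x f (J f) = 0" for x
      \<comment> \<open>The choice of -Jx is made because J(-Jx) = x and K(-Jx) = Ix.\<close>
      using contr [of x] spec [OF *, of "- J x"] by simp
    then show "nij3 I T x y z = 0"
      by (rule nij3_eq_0 [OF span])
  qed
qed

section \<open>Metric connections with skew torsion\<close>

lemma smooth_on_const: "smooth_on S (\<lambda>_. v)"
proof -
  have "Ck_on k S (\<lambda>_. v)" for k
    by (induction k arbitrary: v) (simp_all add: frechet_derivative_const)
  then show ?thesis
    by (simp add: smooth_on_def)
qed

text \<open>Constant fields realise arbitrary tangent vectors at a point and have vanishing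
  brackets, so field conditions can be tested on them.\<close>

lemma const_in_vector_fields: "(\<lambda>_. v) \<in> vector_fields c"
  by (simp add: vector_fields_def smooth_on_const)

lemma cov_deriv_const: "cov_deriv \<Gamma> (\<lambda>_. u) (\<lambda>_. v) x = \<Gamma> x u v"
  by (simp add: cov_deriv_def frechet_derivative_const)

text \<open>With \<open>G\<close> the connection coefficients at a point, this is the torsion on
  constant fields, with its index lowered by \<open>h\<close>.\<close>

definition torsion_form ::
  "('v \<Rightarrow> 'v \<Rightarrow> real) \<Rightarrow> ('v \<Rightarrow> 'v \<Rightarrow> 'v) \<Rightarrow> 'v \<Rightarrow> 'v \<Rightarrow> 'v::real_vector \<Rightarrow> real" where
  "torsion_form h G u v w = h (G u v - G v u) w"

locale skew_metric_connection =
  fixes A :: "('a, 'n::finite) chart set" and g :: "('a, 'n) form2_field"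
    and \<Gamma> :: "('a, 'n) christoffel_field" and c :: "('a, 'n) chart" and x :: "real^'n"
  assumes metric: "riemannian_metric A g" and connection: "linear_connection A \<Gamma>"
    and parallel: "parallel_metric A \<Gamma> g" and skew_torsion: "skew_torsion A \<Gamma> g"
    and chart: "c \<in> A" and point: "x \<in> chart_image c"
begin

sublocale inner_form "g c x"
  using metric chart point by (auto simp: riemannian_metric_def intro!: inner_form.intro)

abbreviation T :: "real^'n \<Rightarrow> real^'n \<Rightarrow> real^'n \<Rightarrow> real" where
  "T \<equiv> torsion_form (g c x) (\<Gamma> c x)"

lemma bilinear_\<Gamma>: "bilinear (\<Gamma> c x)"
  using connection chart point by (auto simp: linear_connection_def)

lemma T_skew: "T u v w = - T u w v"
proof -
  have "g c x (torsion (\<Gamma> c) X Y x) (Z x) = - g c x (torsion (\<Gamma> c) X Z x) (Y x)"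
    if "X \<in> vector_fields c" "Y \<in> vector_fields c" "Z \<in> vector_fields c" for X Y Z
    using skew_torsion chart point that unfolding skew_torsion_def by blast
  from this [OF const_in_vector_fields [of u] const_in_vector_fields [of v] const_in_vector_fields [of w]] show ?thesis
    by (simp add: torsion_def cov_deriv_const lie_bracket_def frechet_derivative_const torsion_form_def)
qed

sublocale T: three_form T
proof (rule three_form.intro)
  show "linear (\<lambda>u. T u v w)" for v w
    using bilinear_\<Gamma>
    by (auto intro!: linearI simp: torsion_form_def bilinear_ladd bilinear_radd bilinear_lmul
        bilinear_rmul algebra_simps)
  show "T v u w = - T u v w" for u v w
    by (simp add: torsion_form_def)
  show "T u w v = - T u v w" for u v w
    by (rule T_skew)
qed

text \<open>Only two of the fields are made constant: \<open>Z\<close> stays general so that it can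
  later be the field \<open>J c y w\<close> from the Kaehler form.\<close>

lemma metric_deriv:
  assumes "Z \<in> vector_fields c"
  shows "frechet_derivative (\<lambda>y. g c y v (Z y)) (at x) u =
    g c x (\<Gamma> c x u v) (Z x) + g c x v (cov_deriv (\<Gamma> c) (\<lambda>_. u) Z x)"
proof -
  have "frechet_derivative (\<lambda>y. g c y (Y y) (Z y)) (at x) (X x) =
      g c x (cov_deriv (\<Gamma> c) X Y x) (Z x) + g c x (Y x) (cov_deriv (\<Gamma> c) X Z x)"
    if "X \<in> vector_fields c" "Y \<in> vector_fields c" for X Y
    using parallel chart point that assms unfolding parallel_metric_def by blast
  from this [OF const_in_vector_fields [of u] const_in_vector_fields [of v]] show ?thesis
    by (simp add: cov_deriv_const)
qed

text \<open>Insert metric compatibility into the Koszul combination. Besides the symmetric part of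
  \<open>\<Gamma>\<close> there remains T(v,l,w) + T(w,l,v), which is zero because the torsion is
  totally skew.\<close>

lemma levi_civita_eq: "levi_civita (g c) x v w = (1 / 2) *\<^sub>R (\<Gamma> c x v w + \<Gamma> c x w v)"
proof -
  note const_deriv = metric_deriv [OF const_in_vector_fields, unfolded cov_deriv_const]
  have "frechet_derivative (\<lambda>y. g c y w l) (at x) v + frechet_derivative (\<lambda>y. g c y v l) (at x) w -
      frechet_derivative (\<lambda>y. g c y v w) (at x) l = g c x (\<Gamma> c x v w + \<Gamma> c x w v) l" for l
    using T_skew [of v l w] T.swap12 [of l v w] T.swap12 [of l w v] T_skew [of l v w]
      sym [of w "\<Gamma> c x v l"] sym [of w "\<Gamma> c x l v"] sym [of v "\<Gamma> c x w l"] sym [of v "\<Gamma> c x l w"]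
    by (simp add: const_deriv torsion_form_def)
  then show ?thesis
    using metric_inverse_component [OF inner_form_axioms, where z = "\<Gamma> c x v w + \<Gamma> c x w v"]
    by (simp add: levi_civita_def metric_inverse_def vec_eq_iff)
qed

end

section \<open>Almost complex structures parallel for the connection\<close>

locale parallel_structure = skew_metric_connection A g \<Gamma> c x
  for A :: "('a, 'n::finite) chart set" and g :: "('a, 'n) form2_field"
    and \<Gamma> :: "('a, 'n) christoffel_field" and c :: "('a, 'n) chart" and x :: "real^'n" +
  fixes J :: "('a, 'n) endo_field"
  assumes endo: "endomorphism_field A J" and parallel_J: "parallel_endo A \<Gamma> J"
    and J_square [simp]: "J c x (J c x v) = - v"
    and J_isometry: "g c x (J c x v) (J c x w) = g c x v w"
begin

lemma linear_J: "linear (J c x)"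
  using endo chart point by (auto simp: endomorphism_field_def)

lemmas J_simps [simp] =
  linear_J [THEN linear_add] linear_J [THEN linear_diff] linear_J [THEN linear_neg] linear_J [THEN linear_scale]

lemma J_skew: "g c x (J c x v) w = - g c x v (J c x w)"
  using J_isometry [of v "J c x w"] by simp

text \<open>The direction enters \<open>cov_deriv\<close> only through its value at
  \<open>x\<close>, so a constant field can stand in for it. This covers the direction
  \<open>J c y (X y)\<close> in the Nijenhuis tensor without a smoothness proof.\<close>

lemma cov_deriv_J:
  assumes "Y \<in> vector_fields c"
  shows "cov_deriv (\<Gamma> c) X (\<lambda>y. J c y (Y y)) x = J c x (cov_deriv (\<Gamma> c) X Y x)"
proof -
  have "cov_deriv (\<Gamma> c) P (\<lambda>y. J c y (Y y)) x = J c x (cov_deriv (\<Gamma> c) P Y x)"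
    if "P \<in> vector_fields c" for P
    using parallel_J chart point that assms unfolding parallel_endo_def by blast
  from this [OF const_in_vector_fields [of "X x"]] show ?thesis
    by (simp add: cov_deriv_def)
qed

text \<open>The Kaehler form is parallel for \<open>\<Gamma>\<close>, so only the difference between
  \<open>\<Gamma>\<close> and the Levi-Civita connection, half the torsion, acts on its two
  arguments.\<close>

lemma cov_deriv_kaehler:
  "cov_deriv_form2 (levi_civita (g c)) (kaehler_form (g c) (J c)) x u v w =
    1 / 2 * (T u v (J c x w) - T u w (J c x v))"
proof -
  have "(\<lambda>y. J c y w) \<in> vector_fields c"
    using endo chart by (auto simp: endomorphism_field_def vector_fields_def)
  then have "frechet_derivative (\<lambda>y. g c y v (J c y w)) (at x) u =
      g c x (\<Gamma> c x u v) (J c x w) + g c x v (J c x (\<Gamma> c x u w))"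
    by (simp add: metric_deriv cov_deriv_J const_in_vector_fields cov_deriv_const)
  moreover have "g c x v (J c x z) = - g c x z (J c x v)" for z
    using J_skew [of v z] sym [of z "J c x v"] by simp
  note this [of "\<Gamma> c x u w"] this [of "\<Gamma> c x w u"]
  ultimately show ?thesis
    by (simp add: cov_deriv_form2_def kaehler_form_def levi_civita_eq torsion_form_def field_simps)
qed

text \<open>The basis \<open>U\<close> reduces the trace to diagonal terms, where one of the two
  torsion terms, T(u,u,.), drops out.\<close>

lemma lee_form_eq:
  assumes "orthonormal U" "finite U" "span U = UNIV"
  shows "lee_form (g c) (J c) x v = - 1 / 2 * metric_trace (g c x) (\<lambda>u w. T (J c x v) u (J c x w))"
proof -
  have bil: "bilinear (\<lambda>u w. 1 / 2 * (T u w (J c x z) - T u z (J c x w)))"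
    "bilinear (\<lambda>u w. T z u (J c x w))" for z
    by (auto simp: bilinear_def algebra_simps add_divide_distrib intro!: linearI)
  have "lee_form (g c) (J c) x v =
      - metric_trace (g c x) (\<lambda>u w. 1 / 2 * (T u w (J c x (J c x v)) - T u (J c x v) (J c x w)))"
    by (simp add: lee_form_def codifferential_def cov_deriv_kaehler metric_trace_def metric_inverse_def)
  also have "\<dots> = - (\<Sum>u\<in>U. 1 / 2 * (T u u (J c x (J c x v)) - T u (J c x v) (J c x u)))"
    by (simp only: metric_trace_orthonormal [OF inner_form_axioms assms bil(1)])
  also have "\<dots> = - 1 / 2 * (\<Sum>u\<in>U. T (J c x v) u (J c x u))"
    by (simp add: T.swap12 [of _ "J c x v"] sum_distrib_left sum_negf)
  also have "\<dots> = - 1 / 2 * metric_trace (g c x) (\<lambda>u w. T (J c x v) u (J c x w))"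
    by (simp only: metric_trace_orthonormal [OF inner_form_axioms assms bil(2)])
  finally show ?thesis .
qed

text \<open>Write each bracket as covariant derivatives minus torsion. As \<open>J\<close> is
  parallel, the derivatives cancel, and lowering the index of the torsion terms gives
  \<open>nij3\<close>.\<close>

lemma nijenhuis_eq:
  assumes "X \<in> vector_fields c" "Y \<in> vector_fields c"
  shows "g c x (nijenhuis (J c) X Y x) z = nij3 (J c x) T (X x) (Y x) z"
proof -
  have bracket: "lie_bracket P Q x =
      cov_deriv (\<Gamma> c) P Q x - cov_deriv (\<Gamma> c) Q P x - (\<Gamma> c x (P x) (Q x) - \<Gamma> c x (Q x) (P x))" for P Q
    by (simp add: lie_bracket_def cov_deriv_def)
  show ?thesis
    by (simp add: nijenhuis_def Let_def bracket cov_deriv_J assms nij3_def torsion_form_def J_skew)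
qed

lemma nijenhuis_eq_0_iff:
  "(\<forall>X\<in>vector_fields c. \<forall>Y\<in>vector_fields c. nijenhuis (J c) X Y x = 0) \<longleftrightarrow>
    (\<forall>u v w. nij3 (J c x) T u v w = 0)"
proof (intro iffI allI ballI)
  fix u v w
  assume "\<forall>X\<in>vector_fields c. \<forall>Y\<in>vector_fields c. nijenhuis (J c) X Y x = 0"
  then have "nijenhuis (J c) (\<lambda>_. u) (\<lambda>_. v) x = 0"
    using const_in_vector_fields by blast
  then show "nij3 (J c x) T u v w = 0"
    using nijenhuis_eq [OF const_in_vector_fields const_in_vector_fields, of u v w] by simp
next
  fix X Y
  assume "\<forall>u v w. nij3 (J c x) T u v w = 0" "X \<in> vector_fields c" "Y \<in> vector_fields c"
  then show "nijenhuis (J c) X Y x = 0"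
    by (intro nondegenerate) (simp add: nijenhuis_eq)
qed

end

section \<open>From the pointwise equivalence to the manifold\<close>

theorem corollary9p3:
  fixes M :: "'a topology" and A :: "('a, 8) chart set"
    and g :: "('a, 8) form2_field" and J1 J2 J3 :: "('a, 8) endo_field"
  assumes "AHKT M A g J1 J2 J3"
  shows "HKT M A g J1 J2 J3 \<longleftrightarrow>
    (\<forall>c\<in>A. \<forall>x\<in>chart_image c. \<forall>v.
       lee_form (g c) (J1 c) x v = lee_form (g c) (J2 c) x v \<and>
       lee_form (g c) (J2 c) x v = lee_form (g c) (J3 c) x v)"
proof -
  obtain \<Gamma> where \<Gamma>: "linear_connection A \<Gamma>" "parallel_metric A \<Gamma> g" "skew_torsion A \<Gamma> g"
      "parallel_endo A \<Gamma> J1" "parallel_endo A \<Gamma> J2" "parallel_endo A \<Gamma> J3"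
    and ah: "almost_hyperhermitian M A g J1 J2 J3"
    using assms by (auto simp: AHKT_def)
  have pointwise: "(\<forall>J\<in>{J1, J2, J3}. \<forall>X\<in>vector_fields c. \<forall>Y\<in>vector_fields c. nijenhuis (J c) X Y x = 0) \<longleftrightarrow>
      (\<forall>v. lee_form (g c) (J1 c) x v = lee_form (g c) (J2 c) x v \<and>
         lee_form (g c) (J2 c) x v = lee_form (g c) (J3 c) x v)"
    if c: "c \<in> A" and x: "x \<in> chart_image c" for c x
  proof -
    interpret skew_metric_connection A g \<Gamma> c x
      using ah \<Gamma> c x by unfold_locales (auto simp: almost_hyperhermitian_def)
    have ps: "parallel_structure A g \<Gamma> c x J" if "J \<in> {J1, J2, J3}" for J
      using that ah \<Gamma> c x by unfold_locales (auto simp: almost_hyperhermitian_def)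
    interpret P1: parallel_structure A g \<Gamma> c x J1 by (rule ps) simp
    interpret P2: parallel_structure A g \<Gamma> c x J2 by (rule ps) simp
    interpret P3: parallel_structure A g \<Gamma> c x J3 by (rule ps) simp
    interpret H1: hyperhermitian_space "g c x" "J1 c x" "J2 c x" "J3 c x"
      by (intro hyperhermitian_space.intro inner_form_axioms hyperhermitian_space_axioms.intro
          P1.linear_J P2.linear_J P3.linear_J P1.J_square P2.J_square P3.J_square
          P1.J_isometry P2.J_isometry P3.J_isometry)
        (use ah c x in \<open>auto simp: almost_hyperhermitian_def\<close>)
    interpret H2: hyperhermitian_space "g c x" "J2 c x" "J3 c x" "J1 c x"
      by (rule H1.rotate)
    interpret H3: hyperhermitian_space "g c x" "J3 c x" "J1 c x" "J2 c x"
      by (rule H2.rotate)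
    obtain U where U: "orthonormal U" "finite U" "span U = UNIV"
      by (rule H1.adapted_basis) (auto simp: H1.line_def)
    \<comment> \<open>Integrability of each structure at \<open>x\<close> amounts to equality of the
      other two Lee forms; the factor -1/2 cancels. The rotated spaces \<open>H2\<close> and
      \<open>H3\<close> give the other two cases.\<close>
    have J1: "(\<forall>X\<in>vector_fields c. \<forall>Y\<in>vector_fields c. nijenhuis (J1 c) X Y x = 0) \<longleftrightarrow>
        (\<forall>v. lee_form (g c) (J2 c) x v = lee_form (g c) (J3 c) x v)"
      unfolding P1.nijenhuis_eq_0_iff P2.lee_form_eq [OF U] P3.lee_form_eq [OF U]
        nij3_eq_0_iff_traces [OF hyperhermitian_three_form.intro
          [OF H1.hyperhermitian_space_axioms T.three_form_axioms]]
      by simp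
    have J2: "(\<forall>X\<in>vector_fields c. \<forall>Y\<in>vector_fields c. nijenhuis (J2 c) X Y x = 0) \<longleftrightarrow>
        (\<forall>v. lee_form (g c) (J3 c) x v = lee_form (g c) (J1 c) x v)"
      unfolding P2.nijenhuis_eq_0_iff P3.lee_form_eq [OF U] P1.lee_form_eq [OF U]
        nij3_eq_0_iff_traces [OF hyperhermitian_three_form.intro
          [OF H2.hyperhermitian_space_axioms T.three_form_axioms]]
      by simp
    have J3: "(\<forall>X\<in>vector_fields c. \<forall>Y\<in>vector_fields c. nijenhuis (J3 c) X Y x = 0) \<longleftrightarrow>
        (\<forall>v. lee_form (g c) (J1 c) x v = lee_form (g c) (J2 c) x v)"
      unfolding P3.nijenhuis_eq_0_iff P1.lee_form_eq [OF U] P2.lee_form_eq [OF U]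
        nij3_eq_0_iff_traces [OF hyperhermitian_three_form.intro
          [OF H3.hyperhermitian_space_axioms T.three_form_axioms]]
      by simp
    show ?thesis
      unfolding ball_simps J1 J2 J3 by metis
  qed
  have "HKT M A g J1 J2 J3 \<longleftrightarrow> (\<forall>c\<in>A. \<forall>x\<in>chart_image c. \<forall>J\<in>{J1, J2, J3}.
      \<forall>X\<in>vector_fields c. \<forall>Y\<in>vector_fields c. nijenhuis (J c) X Y x = 0)"
    using assms unfolding HKT_def integrable_acs_def by blast
  also have "\<dots> \<longleftrightarrow> (\<forall>c\<in>A. \<forall>x\<in>chart_image c. \<forall>v.
       lee_form (g c) (J1 c) x v = lee_form (g c) (J2 c) x v \<and>
       lee_form (g c) (J2 c) x v = lee_form (g c) (J3 c) x v)"
    by (intro ball_cong refl pointwise)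
  finally show ?thesis .
qed

end
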